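(* Let $n \in \mathbb{N}$ and $\delta \in (0,1)$ be parameters, where $\delta$ is an inverse power of two. Consider any greedy open-addressed hash table with capacity $n$. If $(1-\delta)n$ elements are inserted into the hash table, then the final insertion takes expected time $\Omega(\log^2 \delta^{-1})$, where the implied constant is absolute (independent of $n$, $\delta$ and the scheme).
   Context: An open-addressed hash table with capacity $n$ consists of an array of $n$ slots indexed by $[n]$, initially empty. Keys are inserted one after another; each key $x$ comes with an infinite probe sequence $h_1(x),h_2(x),\dots\in[n]^\infty$, the probe sequences of the keys being drawn independently from a common distribution. Elements are never moved after being placed. The table is greedy if each key is placed into the first unoccupied slot of its probe sequence; the time of an insertion is the number of slots of the probe sequence it examines (for a greedy table, the index of the first unoccupied slot in the probe sequence). $\log$ denotes the base-2 logarithm. *)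

theory Defs
  imports "HOL-Probability.Probability"
begin

text \<open>A table maps each slot to the key stored there, if any; its domain is the set of occupied slots.
  Probe sequences are indexed from \<open>0\<close>, so the \<open>j\<close>-th probe of the mathematical text is \<open>h (j - 1)\<close>.\<close>

type_synonym probe_seq = "nat \<Rightarrow> nat"

type_synonym table = "nat \<Rightarrow> nat option"

text \<open>The first condition also fixes \<open>space D\<close> to be the set of all sequences with values in \<open>{1..n}\<close>.\<close>

definition probe_distribution :: "nat \<Rightarrow> probe_seq measure \<Rightarrow> bool" where
  "probe_distribution n D \<longleftrightarrow>
     sets D = sets (Pi\<^sub>M UNIV (\<lambda>_::nat. count_space {1..n})) \<and> prob_space D"

definition first_free :: "table \<Rightarrow> probe_seq \<Rightarrow> nat" where
  "first_free T h = (LEAST j. T (h j) = None)"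

text \<open>A probe sequence need not visit every slot. If it only visits occupied slots, the search never
  ends: the insertion time is infinite and the table stays as it is.\<close>

definition greedy_insert :: "nat \<Rightarrow> probe_seq \<Rightarrow> table \<Rightarrow> table" where
  "greedy_insert x h T =
     (if \<exists>j. T (h j) = None then T(h (first_free T h) \<mapsto> x) else T)"

definition insertion_time :: "table \<Rightarrow> probe_seq \<Rightarrow> enat" where
  "insertion_time T h =
     (if \<exists>j. T (h j) = None then enat (Suc (first_free T h)) else \<infinity>)"

text \<open>The keys are named \<open>0, 1, 2, \<dots>\<close> in order of insertion, key \<open>i\<close> having probe sequence \<open>H i\<close>;
  \<open>greedy_table H i\<close> is the table after the keys below \<open>i\<close> have been inserted.\<close>

primrec greedy_table :: "(nat \<Rightarrow> probe_seq) \<Rightarrow> nat \<Rightarrow> table" where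
  "greedy_table H 0 = Map.empty"
| "greedy_table H (Suc i) = greedy_insert i (H i) (greedy_table H i)"

text \<open>Expected time of the last of \<open>m > 0\<close> insertions; the product measure makes the \<open>m\<close> probe
  sequences independent with common distribution \<open>D\<close>.\<close>

definition expected_final_time :: "probe_seq measure \<Rightarrow> nat \<Rightarrow> ennreal" where
  "expected_final_time D m =
     (\<integral>\<^sup>+ H. ennreal_of_enat (insertion_time (greedy_table H (m - 1)) (H (m - 1)))
        \<partial>Pi\<^sub>M {..<m} (\<lambda>_. D))"

end

theory Submission
  imports Defs
begin

text \<open>The last insertion takes at least as many steps as it examines distinct slots, so its expected
  time is at least the expectation of \<open>\<Sum>s. \<lambda> s A\<close>, where \<open>A\<close> is the final set of occupied slots and
  \<open>\<lambda> s A\<close> is the probability that a fresh key examines slot \<open>s\<close>. Fix \<open>i < q\<close>, where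
  \<open>q\<close> is a small multiple of \<open>k = log (1/\<delta>)\<close>, and put \<open>w = n / 2^i\<close>. As \<open>\<lambda> s\<close> is monotone, a
  slot that is free when \<open>w\<close> slots are free and satisfies \<open>\<lambda> s A \<le> q / w\<close> at the end has been
  threatened by about \<open>w\<close> keys with probability at most \<open>q / w\<close> each, and so remains free almost until
  the end with probability about \<open>e^(-q)\<close>. Almost no slots remain free, hence at least \<open>3w/4\<close>
  slots have \<open>\<lambda> s A > q / w\<close> on average. Summing these layers over \<open>i\<close> gives order \<open>q\<^sup>2\<close>.\<close>

section \<open>Occupied sets under greedy insertion\<close>

text \<open>Search times depend only on which slots are occupied, so the process is tracked through
  the domain of the table and the keys are forgotten.\<close>

definition fill :: "nat set \<Rightarrow> probe_seq \<Rightarrow> nat set" where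
  "fill A h = (if \<exists>j. h j \<notin> A then insert (h (LEAST j. h j \<notin> A)) A else A)"

lemma dom_greedy_insert: "dom (greedy_insert x h T) = fill (dom T) h"
proof -
  have "T (h j) = None \<longleftrightarrow> h j \<notin> dom T" for j by auto
  then show ?thesis by (simp add: greedy_insert_def fill_def first_free_def)
qed

lemma greedy_table_cong: "(\<And>i. i < t \<Longrightarrow> H i = H' i) \<Longrightarrow> greedy_table H t = greedy_table H' t"
  by (induction t) auto

lemma subset_fill: "A \<subseteq> fill A h"
  by (auto simp: fill_def)

lemma fill_subset: "A \<subseteq> S \<Longrightarrow> range h \<subseteq> S \<Longrightarrow> fill A h \<subseteq> S"
  by (auto simp: fill_def)

text \<open>Monotone coupling: the slot that \<open>h\<close> takes from \<open>A\<close> either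
  lies in \<open>B\<close> already, or is also the first slot of \<open>h\<close> outside
  \<open>B\<close>, because all earlier probes lie in \<open>A\<close>.\<close>

lemma fill_mono:
  assumes "A \<subseteq> B"
  shows "fill A h \<subseteq> fill B h"
proof (cases "\<exists>j. h j \<notin> A")
  case True
  define j where "j = (LEAST j. h j \<notin> A)"
  have j: "h j \<notin> A" and min: "\<And>i. h i \<notin> A \<Longrightarrow> j \<le> i"
    unfolding j_def using LeastI_ex[OF True] by (simp, simp add: Least_le)
  have "h j \<in> fill B h"
  proof (cases "h j \<in> B")
    case True
    then show ?thesis using subset_fill by blast
  next
    case False
    then have "(LEAST i. h i \<notin> B) = j"
      using min assms by (intro Least_equality) auto
    with False show ?thesis by (auto simp: fill_def)
  qed
  then show ?thesis
    using True assms subset_fill[of B h] by (auto simp: fill_def j_def[symmetric])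
qed (use assms subset_fill[of B h] in \<open>auto simp: fill_def\<close>)

lemma fill_eq_self_iff: "fill A h = A \<longleftrightarrow> range h \<subseteq> A"
proof -
  have "h (LEAST j. h j \<notin> A) \<notin> A" if "\<exists>j. h j \<notin> A"
    using that by (rule LeastI_ex)
  then show ?thesis by (auto simp: fill_def)
qed

lemma card_fill: "finite A \<Longrightarrow> card (fill A h) = (if fill A h = A then card A else Suc (card A))"
  by (auto simp: fill_def card_insert_if insert_absorb)

text \<open>Removing \<open>s\<close> makes it free artificially, so landing there means that the
  search in \<open>A\<close> gets as far as \<open>s\<close>.\<close>

lemma fill_remove_witness:
  assumes "s \<in> fill (A - {s}) h"
  shows "\<exists>j. h j = s \<and> (\<forall>i<j. h i \<in> A)"
proof -
  let ?j = "LEAST j. h j \<notin> A - {s}"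
  from assms have "h ?j = s"
    by (auto simp: fill_def split: if_splits)
  moreover have "h i \<in> A" if "i < ?j" for i
    using not_less_Least[OF that] by auto
  ultimately show ?thesis by blast
qed

text \<open>Each counted slot is probed no later than the first free one, and distinct slots need
  distinct probes; a search that never ends has time infinity.\<close>

lemma card_probed_le_insertion_time:
  assumes "finite S"
  shows "enat (card {s\<in>S. s \<in> fill (dom T - {s}) h}) \<le> insertion_time T h"
proof (cases "\<exists>j. T (h j) = None")
  case True
  let ?X = "{s\<in>S. s \<in> fill (dom T - {s}) h}"
  have free: "T (h (first_free T h)) = None"
    unfolding first_free_def using True by (rule LeastI_ex)
  have "?X \<subseteq> h ` {..first_free T h}"
  proof
    fix s assume "s \<in> ?X"
    then obtain j where j: "h j = s" "\<forall>i<j. h i \<in> dom T"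
      using fill_remove_witness by blast
    have "j \<le> first_free T h"
      using j(2) free by (metis domIff linorder_not_less)
    then show "s \<in> h ` {..first_free T h}" using j(1) by auto
  qed
  then have "card ?X \<le> card {..first_free T h}"
    by (meson card_image_le card_mono finite_atMost finite_imageI order_trans)
  then show ?thesis using True by (simp add: insertion_time_def)
next
  case False
  then show ?thesis by (subst insertion_time_def) (simp only: if_False enat_ord_simps)
qed

section \<open>Measurability of a single insertion\<close>

locale probing = prob_space D for D :: "probe_seq measure" +
  fixes n :: nat
  assumes sets_D: "sets D = sets (Pi\<^sub>M UNIV (\<lambda>_::nat. count_space {1..n}))"
begin

lemma range_probe: "h \<in> space D \<Longrightarrow> range h \<subseteq> {1..n}"
  using sets_eq_imp_space_eq[OF sets_D] by (auto simp: space_PiM)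

lemma probe_measurable: "(\<lambda>h. h j) \<in> measurable D (count_space UNIV)"
proof -
  have "(\<lambda>h. h j) \<in> measurable D (count_space {1..n})"
    unfolding measurable_cong_sets[OF sets_D refl] by (rule measurable_component_singleton) simp
  then show ?thesis
    by (rule measurable_compose) (simp add: measurable_count_space_eq1)
qed

lemma fill_measurable: "fill A \<in> measurable D (count_space UNIV)"
proof -
  note [measurable] = probe_measurable
  have P: "Measurable.pred D (\<lambda>h. h j \<notin> A)" for j
    by measurable
  have L: "(\<lambda>h. LEAST j. h j \<notin> A) \<in> measurable D (count_space UNIV)"
    by (rule measurable_Least) (rule P)
  have "(\<lambda>h. h (LEAST j. h j \<notin> A)) \<in> measurable D (count_space UNIV)"
    by (rule measurable_compose_countable[OF _ L]) (rule probe_measurable)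
  then have "(\<lambda>h. insert (h (LEAST j. h j \<notin> A)) A) \<in> measurable D (count_space UNIV)"
    by (rule measurable_compose) simp
  moreover have "Measurable.pred D (\<lambda>h. \<exists>j. h j \<notin> A)"
    using P by measurable
  ultimately show ?thesis
    unfolding fill_def[abs_def] by (intro measurable_If) auto
qed

lemma comp_fill_borel [measurable]:
  "(\<lambda>h. f (fill A h)) \<in> borel_measurable D" for f :: "nat set \<Rightarrow> 'b::topological_space"
  by (rule measurable_compose[OF fill_measurable]) simp

text \<open>From a fixed \<open>A\<close> only finitely many outcomes are possible, \<open>A\<close>
  itself or \<open>A\<close> with one slot of \<open>{1..n}\<close> added, so every \<open>f\<close>
  is bounded along them.\<close>

lemma integrable_fill: "integrable D (\<lambda>h. f (fill A h))" for f :: "nat set \<Rightarrow> real"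
proof (rule integrable_const_bound)
  let ?F = "insert A ((\<lambda>s. insert s A) ` {1..n})"
  have "\<bar>f (fill A h)\<bar> \<le> (\<Sum>B\<in>?F. \<bar>f B\<bar>)" if "h \<in> space D" for h
  proof -
    have "fill A h \<in> ?F" using range_probe[OF that] by (auto simp: fill_def)
    then show ?thesis by (intro member_le_sum) auto
  qed
  then show "AE h in D. norm (f (fill A h)) \<le> (\<Sum>B\<in>?F. \<bar>f B\<bar>)"
    by (intro AE_I2) simp
qed simp

section \<open>The transition operator of the occupied set\<close>

text \<open>The Markov operator of one insertion with a fresh key; \<open>steps t f {}\<close> is
  thus the expectation of \<open>f\<close> at the set occupied after \<open>t\<close>
  insertions.\<close>

definition step :: "(nat set \<Rightarrow> real) \<Rightarrow> nat set \<Rightarrow> real" where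
  "step f A = (\<integral>h. f (fill A h) \<partial>D)"

abbreviation steps :: "nat \<Rightarrow> (nat set \<Rightarrow> real) \<Rightarrow> nat set \<Rightarrow> real" where
  "steps t \<equiv> step ^^ t"

text \<open>The outermost \<open>step\<close> stands for the first insertion; this form splits off
  the last one instead.\<close>

lemma steps_Suc': "steps (Suc t) f = steps t (step f)"
  by (simp add: funpow_swap1)

lemma steps_plus: "steps (a + b) f = steps a (steps b f)"
  by (simp add: funpow_add)

lemma step_const: "step (\<lambda>_. c) A = c"
  by (simp add: step_def prob_space)

lemma step_add: "step (\<lambda>B. f B + g B) A = step f A + step g A"
  by (simp add: step_def integrable_fill)

lemma step_scale: "step (\<lambda>B. c * f B) A = c * step f A"
  by (simp add: step_def)

lemma step_mono:
  assumes "\<And>B. A \<subseteq> B \<Longrightarrow> B \<subseteq> A \<union> {1..n} \<Longrightarrow> f B \<le> g B"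
  shows "step f A \<le> step g A"
  unfolding step_def
proof (intro integral_mono integrable_fill assms subset_fill)
  show "fill A h \<subseteq> A \<union> {1..n}" if "h \<in> space D" for h
    using range_probe[OF that] by (intro fill_subset) auto
qed

lemma steps_mono:
  assumes "\<And>B. A \<subseteq> B \<Longrightarrow> B \<subseteq> A \<union> {1..n} \<Longrightarrow> f B \<le> g B"
  shows "steps t f A \<le> steps t g A"
  using assms
proof (induction t arbitrary: A)
  case (Suc t)
  have "steps t f B \<le> steps t g B" if B: "A \<subseteq> B" "B \<subseteq> A \<union> {1..n}" for B
    by (rule Suc.IH, rule Suc.prems) (use B in auto)
  then show ?case by (auto intro: step_mono)
qed simp

lemma steps_cong:
  assumes "\<And>B. A \<subseteq> B \<Longrightarrow> B \<subseteq> A \<union> {1..n} \<Longrightarrow> f B = g B"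
  shows "steps t f A = steps t g A"
  using assms by (intro antisym steps_mono) auto

lemma steps_const: "steps t (\<lambda>_. c) A = c"
proof (induction t arbitrary: A)
  case (Suc t)
  then have "steps t (\<lambda>_. c) = (\<lambda>_. c)" by auto
  then show ?case by (simp add: step_const)
qed simp

lemma steps_add: "steps t (\<lambda>B. f B + g B) A = steps t f A + steps t g A"
proof (induction t arbitrary: A)
  case (Suc t)
  then have "steps t (\<lambda>B. f B + g B) = (\<lambda>A. steps t f A + steps t g A)" by auto
  then show ?case by (simp add: step_add)
qed simp

lemma steps_scale: "steps t (\<lambda>B. c * f B) A = c * steps t f A"
proof (induction t arbitrary: A)
  case (Suc t)
  then have "steps t (\<lambda>B. c * f B) = (\<lambda>A. c * steps t f A)" by auto
  then show ?case by (simp add: step_scale)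
qed simp

lemma steps_diff: "steps t (\<lambda>B. f B - g B) A = steps t f A - steps t g A"
  using steps_add[of t f "\<lambda>B. (- 1) * g B" A] steps_scale[of t "- 1" g A] by simp

lemma steps_sum: "finite I \<Longrightarrow> steps t (\<lambda>B. \<Sum>i\<in>I. f i B) A = (\<Sum>i\<in>I. steps t (f i) A)"
  by (induction I rule: finite_induct) (simp_all add: steps_const steps_add)

lemma step_mono_fun:
  assumes "mono f"
  shows "mono (step f)"
proof (rule monoI)
  fix A B :: "nat set"
  assume "A \<subseteq> B"
  then show "step f A \<le> step f B"
    unfolding step_def using monoD[OF assms fill_mono] by (simp add: integral_mono integrable_fill)
qed

lemma mono_le_step: "mono f \<Longrightarrow> f A \<le> step f A"
  using step_mono[of A "\<lambda>_. f A" f] by (simp add: step_const monoD)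

lemma antimono_step_le: "antimono f \<Longrightarrow> step f A \<le> f A"
  using step_mono[of A f "\<lambda>_. f A"] by (simp add: step_const antimonoD)

lemma antimono_step:
  assumes "antimono f"
  shows "antimono (step f)"
proof (rule antimonoI)
  fix A B :: "nat set"
  assume "A \<subseteq> B"
  then show "step f B \<le> step f A"
    unfolding step_def using antimonoD[OF assms fill_mono] by (simp add: integral_mono integrable_fill)
qed

lemma antimono_steps: "antimono f \<Longrightarrow> antimono (steps t f)"
  by (induction t) (auto intro: antimono_step)

lemma steps_mono_time:
  assumes "mono f" and "u \<le> t"
  shows "steps u f A \<le> steps t f A"
proof (rule lift_Suc_mono_le[OF _ assms(2)])
  show "steps k f A \<le> steps (Suc k) f A" for k
    unfolding steps_Suc' by (intro steps_mono mono_le_step assms(1))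
qed

lemma steps_antimono_time:
  assumes "antimono f" and "u \<le> t"
  shows "steps t f A \<le> steps u f A"
proof (rule lift_Suc_antimono_le[OF _ assms(2)])
  show "steps (Suc k) f A \<le> steps k f A" for k
    unfolding steps_Suc' by (intro steps_mono antimono_step_le assms(1))
qed

section \<open>Probability that a key examines a given slot\<close>

text \<open>A key examines \<open>s\<close> iff it would land in \<open>s\<close> were \<open>s\<close> free.\<close>

definition probe_prob :: "nat \<Rightarrow> nat set \<Rightarrow> real" where
  "probe_prob s A = step (\<lambda>B. of_bool (s \<in> B)) (A - {s})"

lemma probe_prob_nonneg: "0 \<le> probe_prob s A"
  by (simp add: probe_prob_def step_def)

lemma mono_probe_prob: "mono (probe_prob s)"
proof (rule monoI)
  fix A B :: "nat set"
  assume "A \<subseteq> B"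
  moreover have "mono (step (\<lambda>B. of_bool (s \<in> B)))"
    by (intro step_mono_fun monoI) auto
  ultimately show "probe_prob s A \<le> probe_prob s B"
    unfolding probe_prob_def by (auto intro: monoD)
qed

lemma antimono_probe_prob_le: "antimono (\<lambda>A. of_bool (probe_prob s A \<le> l) :: real)"
proof (rule antimonoI)
  fix A B :: "nat set"
  assume "A \<subseteq> B"
  then have "probe_prob s A \<le> probe_prob s B"
    by (rule monoD[OF mono_probe_prob])
  then show "of_bool (probe_prob s B \<le> l) \<le> (of_bool (probe_prob s A \<le> l) :: real)"
    by simp
qed

lemma antimono_free_probe_prob_le:
  "antimono (\<lambda>A. of_bool (s \<notin> A \<and> probe_prob s A \<le> l) :: real)"
proof (rule antimonoI)
  fix A B :: "nat set"
  assume "A \<subseteq> B"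
  then show "of_bool (s \<notin> B \<and> probe_prob s B \<le> l)
      \<le> (of_bool (s \<notin> A \<and> probe_prob s A \<le> l) :: real)"
    using monoD[OF mono_probe_prob, of A B s] by auto
qed

text \<open>A run whose final table has a small probe probability of \<open>s\<close> is compared with runs that leave
  \<open>s\<close> free: when a key lands in \<open>s\<close>, monotonicity allows one to discard that key instead. Each
  discarding costs a factor \<open>l\<close>, and more than \<open>J\<close> of them are unlikely.\<close>

lemma steps_probe_prob_le:
  assumes "0 \<le> l" and "s \<notin> A"
  shows "steps T (\<lambda>A. of_bool (probe_prob s A \<le> l)) A
    \<le> (1 + l) ^ T * steps (T - J) (\<lambda>A. of_bool (s \<notin> A \<and> probe_prob s A \<le> l)) A
      + (1 + 2 * l) ^ T / 2 ^ J"
  using assms(2)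
proof (induction T arbitrary: A J)
  case 0
  then show ?case by simp
next
  case (Suc T)
  define f where "f = (\<lambda>A. of_bool (probe_prob s A \<le> l) :: real)"
  define g where "g = (\<lambda>A. of_bool (s \<notin> A \<and> probe_prob s A \<le> l) :: real)"
  have g0: "0 \<le> steps t g B" for t B
    using steps_mono[of B "\<lambda>_. 0" g t] by (simp add: steps_const g_def)
  have nonneg: "0 \<le> (1 + l) ^ t * steps u g B + (1 + 2 * l) ^ t / 2 ^ K" for t u B K
    using assms(1) g0 by simp
  show ?case
    unfolding f_def[symmetric] g_def[symmetric]
  proof (cases J)
    case 0
    \<comment> \<open>With no discard allowed the error term alone is at least 1.\<close>
    have "steps (Suc T) f A \<le> 1"
      using steps_mono[of A f "\<lambda>_. 1" "Suc T"] by (simp only: steps_const) (simp add: f_def)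
    also have "1 \<le> (1 + 2 * l) ^ Suc T"
      using assms(1) by (intro one_le_power) simp
    also have "\<dots> \<le> (1 + l) ^ Suc T * steps (Suc T - J) g A + (1 + 2 * l) ^ Suc T / 2 ^ J"
      using mult_nonneg_nonneg[OF _ g0[of "Suc T - J" A], of "(1 + l) ^ Suc T"] assms(1)
      unfolding 0 power_0 div_by_1 by (simp del: power_Suc)
    finally show "steps (Suc T) f A \<le> (1 + l) ^ Suc T * steps (Suc T - J) g A + (1 + 2 * l) ^ Suc T / 2 ^ J" .
  next
    case (Suc K)
    define \<Phi> where "\<Phi> = (\<lambda>J A. (1 + l) ^ T * steps (T - J) g A + (1 + 2 * l) ^ T / 2 ^ J)"
    have IH: "steps T f B \<le> \<Phi> J B" if "s \<notin> B" for B J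
      using Suc.IH[OF that, of J] by (simp add: f_def g_def \<Phi>_def)
    have \<Phi>0: "0 \<le> \<Phi> J B" for J B
      unfolding \<Phi>_def by (rule nonneg)
    show "steps (Suc T) f A \<le> (1 + l) ^ Suc T * steps (Suc T - J) g A + (1 + 2 * l) ^ Suc T / 2 ^ J"
    proof (cases "probe_prob s A \<le> l")
      case False
      \<comment> \<open>Probe probabilities only grow, so the indicator stays 0 for the rest of the
        run.\<close>
      then have "f A = 0" by (simp add: f_def)
      moreover have "steps (Suc T) f A \<le> steps 0 f A"
        unfolding f_def by (intro steps_antimono_time antimono_probe_prob_le) simp
      ultimately show ?thesis using nonneg[of "Suc T" "Suc T - J" A J] by simp
    next
      case True
      have "steps (Suc T) f A \<le> step (\<lambda>B. \<Phi> J B + \<Phi> K A * of_bool (s \<in> B)) A"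
        unfolding funpow.simps comp_apply
      proof (rule step_mono)
        \<comment> \<open>If the first key lands in \<open>s\<close>, the run from \<open>B\<close>
          is compared with one from \<open>A\<close>, where \<open>s\<close> is still free, and one
          of the \<open>J\<close> discards is spent.\<close>
        fix B assume "A \<subseteq> B"
        then have "steps T f B \<le> steps T f A"
          unfolding f_def by (rule antimonoD[OF antimono_steps[OF antimono_probe_prob_le]])
        also have "\<dots> \<le> \<Phi> K A" using IH Suc.prems by blast
        finally show "steps T f B \<le> \<Phi> J B + \<Phi> K A * of_bool (s \<in> B)"
          using IH[of B J] \<Phi>0[of J B] by auto
      qed
      also have "\<dots> = step (\<Phi> J) A + \<Phi> K A * probe_prob s A"
        using Suc.prems by (simp add: step_add step_scale probe_prob_def)
      also have "\<dots> \<le> step (\<Phi> J) A + \<Phi> K A * l"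
        using True \<Phi>0 by (intro add_left_mono mult_left_mono)
      also have "step (\<Phi> J) A = (1 + l) ^ T * steps (Suc (T - J)) g A + (1 + 2 * l) ^ T / 2 ^ J"
        by (simp add: \<Phi>_def step_add step_scale step_const)
      \<comment> \<open>Equality if \<open>J \<le> T\<close>; otherwise the truncated subtraction
        leaves fewer steps on the right, which can only increase the value.\<close>
      also have "steps (Suc (T - J)) g A \<le> steps (Suc T - J) g A"
        unfolding g_def by (intro steps_antimono_time antimono_free_probe_prob_le) simp
      \<comment> \<open>Since \<open>J = Suc K\<close>, \<open>T - K\<close> equals
        \<open>Suc T - J\<close>, and the main terms combine with factor \<open>1 + l\<close>. The
        error of the discard branch is divided by \<open>2 ^ K\<close>, twice as large as with
        \<open>2 ^ J\<close>; hence the factor \<open>1 + 2 * l\<close>.\<close>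
      also have "(1 + l) ^ T * steps (Suc T - J) g A + (1 + 2 * l) ^ T / 2 ^ J + \<Phi> K A * l
          = (1 + l) ^ Suc T * steps (Suc T - J) g A + (1 + 2 * l) ^ Suc T / 2 ^ J"
        by (simp add: \<Phi>_def Suc field_simps)
      finally show ?thesis using assms(1) by simp
    qed
  qed
qed

section \<open>Endless searches and the expected number of occupied slots\<close>

definition stuck_prob :: "nat set \<Rightarrow> real" where
  "stuck_prob A = (\<integral>h. of_bool (fill A h = A) \<partial>D)"

lemma stuck_prob_nonneg: "0 \<le> stuck_prob A"
  by (simp add: stuck_prob_def)

lemma mono_stuck_prob: "mono stuck_prob"
proof (rule monoI)
  fix A B :: "nat set"
  assume AB: "A \<subseteq> B"
  have "fill B h = B" if "fill A h = A" for h
    using that AB by (auto simp: fill_eq_self_iff)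
  then show "stuck_prob A \<le> stuck_prob B"
    unfolding stuck_prob_def
    by (intro integral_mono integrable_fill[of "\<lambda>X. of_bool (X = _)"]) auto
qed

lemma step_card:
  assumes "finite A"
  shows "step (\<lambda>B. real (card B)) A = real (card A) + 1 - stuck_prob A"
proof -
  have "step (\<lambda>B. real (card B)) A = step (\<lambda>B. (real (card A) + 1) - of_bool (B = A)) A"
    unfolding step_def using card_fill[OF assms] by (intro Bochner_Integration.integral_cong) auto
  also have "\<dots> = real (card A) + 1 - stuck_prob A"
    using steps_diff[of 1 "\<lambda>_. real (card A) + 1" "\<lambda>B. of_bool (B = A)" A]
    by (simp add: step_const) (simp add: step_def stuck_prob_def)
  finally show ?thesis .
qed

text \<open>Stuck probabilities grow with the occupied set, so a zero expectation at time
  \<open>t\<close> forces zero at all earlier times, and each insertion up to number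
  \<open>Suc t\<close> almost surely adds a slot.\<close>

lemma steps_card:
  assumes "steps t stuck_prob {} = 0" and "u \<le> Suc t"
  shows "steps u (\<lambda>B. real (card B)) {} = real u"
  using assms(2)
proof (induction u)
  case (Suc u)
  have "steps u stuck_prob {} \<le> 0"
    using steps_mono_time[OF mono_stuck_prob, of u t "{}"] Suc.prems assms(1) by simp
  moreover have "0 \<le> steps u stuck_prob {}"
    using steps_mono[of "{}" "\<lambda>_. 0" stuck_prob u] by (simp add: steps_const stuck_prob_nonneg)
  ultimately have z: "steps u stuck_prob {} = 0" by simp
  have "steps (Suc u) (\<lambda>B. real (card B)) {} = steps u (\<lambda>B. (real (card B) + 1) - stuck_prob B) {}"
    unfolding steps_Suc' by (intro steps_cong step_card) (auto intro: finite_subset)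
  also have "\<dots> = real u + 1"
    using Suc by (simp add: steps_diff steps_add steps_const z)
  finally show ?case by simp
qed simp

lemma sum_steps_mem:
  assumes "steps t stuck_prob {} = 0" and "u \<le> Suc t"
  shows "(\<Sum>s\<in>{1..n}. steps u (\<lambda>B. of_bool (s \<in> B)) {}) = real u"
proof -
  have "(\<Sum>s\<in>{1..n}. steps u (\<lambda>B. of_bool (s \<in> B)) {})
      = steps u (\<lambda>B. \<Sum>s\<in>{1..n}. of_bool (s \<in> B)) {}"
    by (simp only: steps_sum finite_atLeastAtMost)
  also have "\<dots> = steps u (\<lambda>B. real (card B)) {}"
    by (intro steps_cong) (auto simp: Int_absorb1)
  finally show ?thesis using steps_card[OF assms] by simp
qed

text \<open>The run is split at time \<open>a\<close>. Slots occupied by then are counted with the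
  trivial bound 1, the others with the discarding bound over the remaining \<open>t - a\<close>
  insertions. The sums over slots are then exact expected counts: \<open>a\<close> occupied at time
  \<open>a\<close>, and \<open>n - t + J\<close> free at time \<open>t - J\<close>.\<close>

lemma sum_steps_probe_prob_le:
  assumes stuck: "steps t stuck_prob {} = 0"
    and l: "0 \<le> l" and a: "a + J \<le> t" and t: "t \<le> n"
  shows "(\<Sum>s\<in>{1..n}. steps t (\<lambda>A. of_bool (probe_prob s A \<le> l)) {})
    \<le> real a + (1 + l) ^ (t - a) * (real n - real t + real J)
      + (1 + 2 * l) ^ (t - a) / 2 ^ J * (real n - real a)"
proof -
  define T where "T = t - a"
  define \<alpha> where "\<alpha> = (1 + l) ^ T"
  define \<epsilon> where "\<epsilon> = (1 + 2 * l) ^ T / 2 ^ J"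
  have nonneg: "0 \<le> \<alpha>" "0 \<le> \<epsilon>"
    using l by (auto simp: \<alpha>_def \<epsilon>_def)
  define p where "p = (\<lambda>u s. steps u (\<lambda>B. of_bool (s \<in> B)) {})"
  have free: "steps u (\<lambda>B. of_bool (s \<notin> B)) {} = 1 - p u s" for u s
    using steps_diff[of u "\<lambda>_. 1" "\<lambda>B. of_bool (s \<in> B)" "{}"]
    by (simp add: p_def steps_const of_bool_not_iff)
  have "steps t (\<lambda>A. of_bool (probe_prob s A \<le> l)) {}
      \<le> p a s + \<alpha> * (1 - p (t - J) s) + \<epsilon> * (1 - p a s)" for s
  proof -
    let ?f = "\<lambda>A. of_bool (probe_prob s A \<le> l) :: real"
    have "steps t ?f {} = steps a (steps T ?f) {}"
      using steps_plus[of a T ?f] a by (simp add: T_def)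
    also have "\<dots> \<le> steps a (\<lambda>A. of_bool (s \<in> A) + \<alpha> * steps (T - J) (\<lambda>B. of_bool (s \<notin> B)) A
        + \<epsilon> * of_bool (s \<notin> A)) {}"
    proof (rule steps_mono)
      fix A
      have mid: "0 \<le> steps (T - J) (\<lambda>B. of_bool (s \<notin> B)) A"
        using steps_mono[of A "\<lambda>_. 0" "\<lambda>B. of_bool (s \<notin> B)" "T - J"] by (simp add: steps_const)
      show "steps T ?f A \<le> of_bool (s \<in> A) + \<alpha> * steps (T - J) (\<lambda>B. of_bool (s \<notin> B)) A
        + \<epsilon> * of_bool (s \<notin> A)"
      proof (cases "s \<in> A")
        case True
        have "steps T ?f A \<le> 1"
          using steps_mono[of A ?f "\<lambda>_. 1" T] by (simp add: steps_const)
        then show ?thesis using True mid nonneg by (simp add: add_increasing2)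
      next
        case False
        have "steps (T - J) (\<lambda>A. of_bool (s \<notin> A \<and> probe_prob s A \<le> l)) A
            \<le> steps (T - J) (\<lambda>B. of_bool (s \<notin> B)) A"
          by (intro steps_mono) auto
        then show ?thesis
          using steps_probe_prob_le[OF l False, of T J] False nonneg
          by (simp add: \<alpha>_def[symmetric] \<epsilon>_def[symmetric]) (smt (verit) mult_left_mono)
      qed
    qed
    also have "\<dots> = p a s + \<alpha> * steps a (steps (T - J) (\<lambda>B. of_bool (s \<notin> B))) {}
        + \<epsilon> * (1 - p a s)"
      by (simp add: steps_add steps_scale free) (simp add: p_def)
    also have "steps a (steps (T - J) (\<lambda>B. of_bool (s \<notin> B))) {} = 1 - p (t - J) s"
      using steps_plus[of a "T - J" "\<lambda>B. of_bool (s \<notin> B)"] a by (simp add: T_def free[symmetric])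
    finally show ?thesis .
  qed
  then have "(\<Sum>s\<in>{1..n}. steps t (\<lambda>A. of_bool (probe_prob s A \<le> l)) {})
      \<le> (\<Sum>s\<in>{1..n}. p a s + \<alpha> * (1 - p (t - J) s) + \<epsilon> * (1 - p a s))"
    by (intro sum_mono)
  also have "\<dots> = (\<Sum>s\<in>{1..n}. p a s) + \<alpha> * (real n - (\<Sum>s\<in>{1..n}. p (t - J) s))
      + \<epsilon> * (real n - (\<Sum>s\<in>{1..n}. p a s))"
    by (simp add: sum.distrib sum_distrib_left[symmetric] sum_subtractf)
  also have "\<dots> = real a + \<alpha> * (real n - real t + real J) + \<epsilon> * (real n - real a)"
    using a sum_steps_mem[OF stuck, of a] sum_steps_mem[OF stuck, of "t - J"]
    by (simp add: p_def of_nat_diff)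
  finally show ?thesis by (simp add: \<alpha>_def \<epsilon>_def T_def)
qed

section \<open>From the operator to the product measure\<close>

text \<open>With the finite target \<open>Pow {1..n}\<close>, maps depending on a random occupied
  set can be handled by a countable case split over its values.\<close>

lemma fill_measurable_Pow:
  assumes "A \<subseteq> {1..n}"
  shows "fill A \<in> measurable D (count_space (Pow {1..n}))"
proof -
  have "fill A \<in> measurable D (restrict_space (count_space UNIV) (Pow {1..n}))"
  proof (rule measurable_restrict_space2[OF _ fill_measurable])
    show "fill A \<in> space D \<rightarrow> Pow {1..n}"
      using fill_subset[OF assms range_probe] by blast
  qed
  then show ?thesis by (simp add: restrict_count_space)
qed

lemma occupied_measurable:
  "t \<le> m \<Longrightarrow> (\<lambda>H. dom (greedy_table H t)) \<in>
    measurable (Pi\<^sub>M {..<m} (\<lambda>_. D)) (count_space (Pow {1..n}))"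
proof (induction t)
  case (Suc t)
  have "(\<lambda>H. fill A (H t)) \<in> measurable (Pi\<^sub>M {..<m} (\<lambda>_. D)) (count_space (Pow {1..n}))"
    if "A \<in> Pow {1..n}" for A
    by (rule measurable_compose[where g="fill A" and N=D])
      (use Suc.prems that in \<open>auto intro: measurable_component_singleton fill_measurable_Pow simp del: One_nat_def\<close>)
  then show ?case
    using Suc by (simp add: dom_greedy_insert)
      (rule measurable_compose_countable'[where I="Pow {1..n}"], auto intro: countable_finite)
qed simp

text \<open>Fubini: the table after \<open>t\<close> keys does not depend on coordinate
  \<open>t\<close>, so the last probe sequence is integrated out separately.\<close>

lemma nn_integral_last_probe:
  assumes "\<And>A. A \<subseteq> {1..n} \<Longrightarrow> G A \<in> borel_measurable D"
  shows "(\<integral>\<^sup>+ H. G (dom (greedy_table H t)) (H t) \<partial>Pi\<^sub>M {..<Suc t} (\<lambda>_. D))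
    = (\<integral>\<^sup>+ H. (\<integral>\<^sup>+ h. G (dom (greedy_table H t)) h \<partial>D) \<partial>Pi\<^sub>M {..<t} (\<lambda>_. D))"
proof -
  interpret product_sigma_finite "\<lambda>_::nat. D" by standard
  have "(\<lambda>H. G (dom (greedy_table H t)) (H t)) \<in> borel_measurable (Pi\<^sub>M {..<Suc t} (\<lambda>_. D))"
  proof (rule measurable_compose_countable'[OF _ occupied_measurable])
    show "(\<lambda>H. G A (H t)) \<in> borel_measurable (Pi\<^sub>M {..<Suc t} (\<lambda>_. D))" if "A \<in> Pow {1..n}" for A
      by (rule measurable_compose[where g="G A" and N=D])
        (use that in \<open>auto intro: measurable_component_singleton assms simp del: One_nat_def\<close>)
  qed (auto intro: countable_finite)
  moreover have "greedy_table (H(t := h)) t = greedy_table H t" for H h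
    by (rule greedy_table_cong) simp
  ultimately show ?thesis
    unfolding lessThan_Suc by (subst product_nn_integral_insert) auto
qed

lemma nn_integral_occupied:
  assumes "\<And>A. 0 \<le> f A"
  shows "(\<integral>\<^sup>+ H. ennreal (f (dom (greedy_table H t))) \<partial>Pi\<^sub>M {..<t} (\<lambda>_. D)) = ennreal (steps t f {})"
  using assms
proof (induction t arbitrary: f)
  case 0
  interpret P: prob_space "Pi\<^sub>M {..<0::nat} (\<lambda>_. D)"
    by (intro prob_space_PiM prob_space_axioms)
  show ?case by (simp add: P.emeasure_space_1 del: lessThan_0)
next
  case (Suc t)
  have "(\<integral>\<^sup>+ H. ennreal (f (dom (greedy_table H (Suc t)))) \<partial>Pi\<^sub>M {..<Suc t} (\<lambda>_. D))
      = (\<integral>\<^sup>+ H. (\<integral>\<^sup>+ h. ennreal (f (fill (dom (greedy_table H t)) h)) \<partial>D) \<partial>Pi\<^sub>M {..<t} (\<lambda>_. D))"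
    unfolding greedy_table.simps dom_greedy_insert by (rule nn_integral_last_probe) simp
  also have "\<dots> = (\<integral>\<^sup>+ H. ennreal (step f (dom (greedy_table H t))) \<partial>Pi\<^sub>M {..<t} (\<lambda>_. D))"
    unfolding step_def
    by (intro nn_integral_cong nn_integral_eq_integral integrable_fill) (simp add: Suc.prems)
  also have "\<dots> = ennreal (steps (Suc t) f {})"
    unfolding steps_Suc' by (rule Suc.IH) (simp add: step_def Suc.prems)
  finally show ?case .
qed

text \<open>The last key is independent of the table it meets, so linearity over slots turns the
  expected number of distinct examined slots into a sum of probe probabilities.\<close>

lemma expected_final_time_ge_probes:
  "ennreal (steps t (\<lambda>A. \<Sum>s\<in>{1..n}. probe_prob s A) {}) \<le> expected_final_time D (Suc t)"
proof -
  let ?N = "\<lambda>A h. \<Sum>s\<in>{1..n}. of_bool (s \<in> fill (A - {s}) h) :: real"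
  have int: "integrable D (\<lambda>h. of_bool (s \<in> fill (A - {s}) h) :: real)" for A s
    by (rule integrable_fill[of "\<lambda>X. of_bool (s \<in> X)"])
  have "ennreal (steps t (\<lambda>A. \<Sum>s\<in>{1..n}. probe_prob s A) {})
      = (\<integral>\<^sup>+ H. ennreal (\<Sum>s\<in>{1..n}. probe_prob s (dom (greedy_table H t))) \<partial>Pi\<^sub>M {..<t} (\<lambda>_. D))"
    by (rule nn_integral_occupied[symmetric]) (simp add: sum_nonneg probe_prob_nonneg)
  also have "\<dots> = (\<integral>\<^sup>+ H. (\<integral>\<^sup>+ h. ennreal (?N (dom (greedy_table H t)) h) \<partial>D) \<partial>Pi\<^sub>M {..<t} (\<lambda>_. D))"
  proof (rule nn_integral_cong)
    fix H
    let ?A = "dom (greedy_table H t)"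
    have "(\<Sum>s\<in>{1..n}. probe_prob s ?A) = (\<integral>h. ?N ?A h \<partial>D)"
      by (simp only: probe_prob_def step_def Bochner_Integration.integral_sum[OF int])
    moreover have "(\<integral>\<^sup>+ h. ennreal (?N ?A h) \<partial>D) = ennreal (\<integral>h. ?N ?A h \<partial>D)"
      by (intro nn_integral_eq_integral Bochner_Integration.integrable_sum int AE_I2 sum_nonneg) simp
    ultimately show "ennreal (\<Sum>s\<in>{1..n}. probe_prob s ?A) = (\<integral>\<^sup>+ h. ennreal (?N ?A h) \<partial>D)"
      by simp
  qed
  also have "\<dots> = (\<integral>\<^sup>+ H. ennreal (?N (dom (greedy_table H t)) (H t)) \<partial>Pi\<^sub>M {..<Suc t} (\<lambda>_. D))"
    by (intro nn_integral_last_probe[symmetric] measurable_compose[OF _ measurable_ennreal]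
        borel_measurable_sum borel_measurable_integrable int)
  also have "\<dots> \<le> expected_final_time D (Suc t)"
    unfolding expected_final_time_def diff_Suc_1
  proof (rule nn_integral_mono)
    fix H
    let ?X = "{s\<in>{1..n}. s \<in> fill (dom (greedy_table H t) - {s}) (H t)}"
    have "ennreal (?N (dom (greedy_table H t)) (H t)) = ennreal_of_enat (enat (card ?X))"
      by (simp add: Int_def ennreal_of_nat_eq_real_of_nat)
    also have "\<dots> \<le> ennreal_of_enat (insertion_time (greedy_table H t) (H t))"
      unfolding ennreal_of_enat_le_iff by (rule card_probed_le_insertion_time) simp
    finally show "ennreal (?N (dom (greedy_table H t)) (H t))
      \<le> ennreal_of_enat (insertion_time (greedy_table H t) (H t))" .
  qed
  finally show ?thesis .
qed

text \<open>The time dominates the function that is \<open>top\<close> when the last key is stuck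
  and 0 otherwise, whose integral is infinite once that event has positive probability.\<close>

lemma expected_final_time_eq_top:
  assumes "steps t stuck_prob {} \<noteq> 0"
  shows "expected_final_time D (Suc t) = \<infinity>"
proof -
  let ?G = "\<lambda>A h. top * ennreal (of_bool (fill A h = A))"
  have pos: "0 < steps t stuck_prob {}"
    using assms steps_mono[of "{}" "\<lambda>_. 0" stuck_prob t]
    by (simp add: steps_const stuck_prob_nonneg order_less_le)
  have "top = top * ennreal (steps t stuck_prob {})"
    using pos by (simp add: ennreal_top_mult)
  also have "\<dots> = top * (\<integral>\<^sup>+ H. ennreal (stuck_prob (dom (greedy_table H t))) \<partial>Pi\<^sub>M {..<t} (\<lambda>_. D))"
    by (simp add: nn_integral_occupied stuck_prob_nonneg)
  also have "\<dots> = (\<integral>\<^sup>+ H. top * ennreal (stuck_prob (dom (greedy_table H t))) \<partial>Pi\<^sub>M {..<t} (\<lambda>_. D))"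
    by (rule nn_integral_cmult[symmetric], rule measurable_compose[OF occupied_measurable[OF order_refl]])
      simp
  also have "\<dots> = (\<integral>\<^sup>+ H. (\<integral>\<^sup>+ h. ?G (dom (greedy_table H t)) h \<partial>D) \<partial>Pi\<^sub>M {..<t} (\<lambda>_. D))"
  proof (rule nn_integral_cong)
    fix H
    let ?A = "dom (greedy_table H t)"
    have meas: "(\<lambda>h. ennreal (of_bool (fill ?A h = ?A))) \<in> borel_measurable D"
      by (rule comp_fill_borel[of "\<lambda>X. ennreal (of_bool (X = ?A))"])
    have "(\<integral>\<^sup>+ h. ennreal (of_bool (fill ?A h = ?A)) \<partial>D) = ennreal (stuck_prob ?A)"
      unfolding stuck_prob_def
      by (intro nn_integral_eq_integral integrable_fill[of "\<lambda>X. of_bool (X = ?A)"]) simp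
    with meas show "top * ennreal (stuck_prob ?A) = (\<integral>\<^sup>+ h. ?G ?A h \<partial>D)"
      by (simp only: nn_integral_cmult)
  qed
  also have "\<dots> = (\<integral>\<^sup>+ H. ?G (dom (greedy_table H t)) (H t) \<partial>Pi\<^sub>M {..<Suc t} (\<lambda>_. D))"
    by (rule nn_integral_last_probe[symmetric]) (rule comp_fill_borel)
  also have "\<dots> \<le> expected_final_time D (Suc t)"
    unfolding expected_final_time_def diff_Suc_1
  proof (rule nn_integral_mono)
    fix H
    let ?T = "greedy_table H t"
    show "?G (dom ?T) (H t) \<le> ennreal_of_enat (insertion_time ?T (H t))"
    proof (cases "range (H t) \<subseteq> dom ?T")
      case True
      then have "insertion_time ?T (H t) = \<infinity>"
        by (auto simp: insertion_time_def)
      then show ?thesis by simp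
    qed (simp add: fill_eq_self_iff)
  qed
  finally show ?thesis by (simp add: top_unique)
qed

lemma expected_final_time_ge_1: "1 \<le> expected_final_time D (Suc t)"
proof -
  interpret P: prob_space "Pi\<^sub>M {..<Suc t} (\<lambda>_. D)"
    by (intro prob_space_PiM prob_space_axioms)
  have "1 = (\<integral>\<^sup>+ H. 1 \<partial>Pi\<^sub>M {..<Suc t} (\<lambda>_. D))"
    by (simp add: P.emeasure_space_1)
  also have "\<dots> \<le> expected_final_time D (Suc t)"
    unfolding expected_final_time_def
    by (intro nn_integral_mono) (auto simp: insertion_time_def simp flip: of_nat_Suc)
  finally show ?thesis .
qed

section \<open>Summing the layers\<close>

text \<open>\<open>N\<close> is the number of slots left free if no search is endless. The slack in
  \<open>16 * q \<le> k\<close> makes each \<open>w i\<close> with \<open>i < q\<close> exceed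
  \<open>N + 1 + 8 * q\<close> by a factor \<open>8 * 4 ^ q\<close>, which absorbs the loss of order
  \<open>e^q\<close>.\<close>

lemma expected_final_time_ge_square:
  assumes q: "1 \<le> q" "16 * q \<le> k" and N: "1 \<le> N" and n: "n = N * 2 ^ k"
    and t: "Suc t = n - N"
  shows "ennreal (3 / 8 * (real q)\<^sup>2) \<le> expected_final_time D (Suc t)"
proof (cases "steps t stuck_prob {} = 0")
  case False
  then show ?thesis by (simp add: expected_final_time_eq_top)
next
  case stuck: True
  define w where "w i = N * 2 ^ (k - i)" for i
  define l where "l i = real q / real (w i)" for i
  have w0: "0 < w i" for i using N by (simp add: w_def)
  have l0: "0 \<le> l i" for i by (simp add: l_def)
  have tn: "real t = real n - real N - 1" "N < n"
    using t by linarith+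
  have small: "3 * real (w i) / 4 \<le> (\<Sum>s\<in>{1..n}. steps t (\<lambda>A. of_bool (l i < probe_prob s A)) {})"
    if i: "i < q" for i
  proof -
    have "2 + 8 * q \<le> 16 ^ q" using q(1)
      by (induction q rule: dec_induct) auto
    then have "N * (2 + 8 * q) \<le> N * 16 ^ q"
      by (rule mult_left_mono) simp
    moreover have "N + 1 + 8 * q \<le> N * (2 + 8 * q)"
      using N by (cases N) auto
    ultimately have "N + 1 + 8 * q \<le> N * 16 ^ q"
      by (rule order_trans[rotated])
    then have "8 * 4 ^ q * (N + 1 + 8 * q) \<le> 8 * 4 ^ q * (N * 16 ^ q)"
      by (rule mult_left_mono) simp
    also have "\<dots> = N * 2 ^ (3 + 6 * q)"
      using power_mult[of "2::nat" 6 q] power_mult_distrib[of "4::nat" 16 q] by (simp add: power_add)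
    also have "\<dots> \<le> w i"
      unfolding w_def using i q by (intro mult_left_mono power_increasing) auto
    finally have room: "8 * 4 ^ q * (N + 1 + 8 * q) \<le> w i" .
    have "1 * (N + 1 + 8 * q) \<le> 8 * 4 ^ q * (N + 1 + 8 * q)"
      by (intro mult_right_mono) auto
    with room have fit: "N + 1 + 8 * q \<le> w i" by (metis mult_1 order_trans)
    have wn: "w i \<le> n"
      unfolding w_def n by (rule mult_left_mono[OF power_increasing]) auto
    \<comment> \<open>At time \<open>a\<close> exactly \<open>w i\<close> slots are expected to be
      free; \<open>8 * q\<close> will be the number \<open>J\<close> of allowed discards.\<close>
    define a where "a = n - w i"
    define T where "T = t - a"
    have a: "a + 8 * q \<le> t" using fit wn t by (simp add: a_def)
    have T: "T \<le> w i" using t wn by (simp add: T_def a_def)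
    have "l i * real T \<le> real q"
      using T w0[of i] mult_left_mono[of "real T" "real (w i)" "real q"]
      by (simp add: l_def field_simps)
    \<comment> \<open>At most \<open>w i\<close> insertions remain, each with threshold
      \<open>q / w i\<close>, so the exponents add up to at most \<open>c * q\<close>; then
      \<open>e < 4\<close>.\<close>
    have power_le: "(1 + c * l i) ^ T \<le> (4 ^ c') ^ q" if c: "c = real c'" for c c'
    proof -
      have "(1 + c * l i) ^ T \<le> exp (c * l i) ^ T"
        using l0[of i] c by (intro power_mono exp_ge_add_one_self) auto
      also have "\<dots> = exp (c * (l i * real T))"
        by (simp add: mult_ac flip: exp_of_nat_mult)
      also have "\<dots> \<le> exp (c * real q)"
        using \<open>l i * real T \<le> real q\<close> c by (simp add: mult_left_mono)
      also have "\<dots> = (exp 1 ^ c') ^ q"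
        by (simp add: c exp_of_nat_mult[symmetric] power_mult[symmetric])
      also have "\<dots> \<le> (4 ^ c') ^ q"
        using exp_le by (intro power_mono) auto
      finally show ?thesis .
    qed
    have "(1 + l i) ^ T * (real n - real t + real (8 * q)) \<le> 4 ^ q * (real N + 1 + 8 * real q)"
      using power_le[of 1 1] tn by (intro mult_mono) auto
    also have "\<dots> \<le> real (w i) / 8"
      using of_nat_mono[OF room, where 'a=real] by (simp add: algebra_simps)
    finally have b1: "(1 + l i) ^ T * (real n - real t + real (8 * q)) \<le> real (w i) / 8" .
    \<comment> \<open>The choice \<open>J = 8 * q\<close> beats the growth \<open>16 ^ q\<close> by
      the factor \<open>16 ^ q\<close> again.\<close>
    have "(1 + 2 * l i) ^ T / 2 ^ (8 * q) \<le> 16 ^ q / 2 ^ (8 * q)"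
      using power_le[of 2 2] by (intro divide_right_mono) auto
    also have "\<dots> = (1 / 16) ^ q"
      by (simp only: power_mult power_divide[symmetric]) simp
    also have "\<dots> \<le> (1 / 16) ^ 1"
      using q(1) by (intro power_decreasing) auto
    also have "\<dots> \<le> (1 / 8 :: real)" by simp
    finally have "(1 + 2 * l i) ^ T / 2 ^ (8 * q) \<le> 1 / 8" .
    then have b2: "(1 + 2 * l i) ^ T / 2 ^ (8 * q) * (real n - real a) \<le> 1 / 8 * real (w i)"
      using wn by (intro mult_mono) (auto simp: a_def)
    have "(\<Sum>s\<in>{1..n}. steps t (\<lambda>A. of_bool (probe_prob s A \<le> l i)) {})
      \<le> real n - 3 * real (w i) / 4"
    proof -
      have "t \<le> n" "real a = real n - real (w i)"
        using t wn by (auto simp: a_def)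
      with sum_steps_probe_prob_le[OF stuck l0 a, of i, folded T_def] b1 b2 show ?thesis
        by linarith
    qed
    moreover have "steps t (\<lambda>A. of_bool (l i < probe_prob s A)) {}
        = 1 - steps t (\<lambda>A. of_bool (probe_prob s A \<le> l i)) {}" for s
      using steps_diff[of t "\<lambda>_. 1" "\<lambda>A. of_bool (probe_prob s A \<le> l i)" "{}"]
      by (simp add: steps_const of_bool_not_iff[symmetric] not_le)
    ultimately show ?thesis by (simp add: sum_subtractf)
  qed
  \<comment> \<open>The thresholds double with \<open>i\<close>, so those below \<open>x\<close>
    form a geometric sum, and half of it is at most \<open>x\<close>. The induction also carries the
    bound \<open>l j / 2\<close>, which covers the case where the next threshold lies below
    \<open>x\<close>.\<close>
  have layers: "(\<Sum>i<q. l i / 2 * of_bool (l i < x)) \<le> x" if "0 \<le> x" for x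
  proof -
    have "(\<Sum>i<j. l i / 2 * of_bool (l i < x)) \<le> x \<and> (\<Sum>i<j. l i / 2 * of_bool (l i < x)) \<le> l j / 2"
      if "j \<le> q" for j
      using that
    proof (induction j)
      case (Suc j)
      have "k - j = Suc (k - Suc j)" using Suc.prems q by simp
      then have "w j = 2 * w (Suc j)" by (simp add: w_def)
      then have "l (Suc j) = 2 * l j" by (simp add: l_def)
      with Suc l0[of j] show ?case by auto
    qed (use \<open>0 \<le> x\<close> l0 in auto)
    then show ?thesis by blast
  qed
  \<comment> \<open>The width \<open>w i\<close> cancels, so all \<open>q\<close> layers contribute
    equally.\<close>
  have "l i / 2 * (3 * real (w i) / 4) = 3 / 8 * real q" for i
    using w0[of i] by (simp add: l_def)
  then have "3 / 8 * (real q)\<^sup>2 = (\<Sum>i<q. l i / 2 * (3 * real (w i) / 4))"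
    by (simp only:) (simp add: power2_eq_square)
  also have "\<dots> \<le> (\<Sum>i<q. l i / 2 * (\<Sum>s\<in>{1..n}. steps t (\<lambda>A. of_bool (l i < probe_prob s A)) {}))"
    using small l0 by (intro sum_mono mult_left_mono) auto
  also have "\<dots> = (\<Sum>s\<in>{1..n}. steps t (\<lambda>A. \<Sum>i<q. l i / 2 * of_bool (l i < probe_prob s A)) {})"
    unfolding sum_distrib_left by (subst sum.swap) (simp only: steps_sum steps_scale finite_lessThan)
  also have "\<dots> \<le> (\<Sum>s\<in>{1..n}. steps t (probe_prob s) {})"
    by (intro sum_mono steps_mono layers probe_prob_nonneg)
  also have "\<dots> = steps t (\<lambda>A. \<Sum>s\<in>{1..n}. probe_prob s A) {}"
    by (simp only: steps_sum finite_atLeastAtMost)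
  finally show ?thesis
    using expected_final_time_ge_probes[of t] by (meson ennreal_leI order_trans)
qed

end

section \<open>The absolute constant\<close>

theorem theorem4:
  "\<exists>c::real. c > 0 \<and>
     (\<forall>(n::nat) (\<delta>::real) (m::nat) (D :: probe_seq measure).
        n > 0 \<longrightarrow> 0 < \<delta> \<longrightarrow> \<delta> < 1 \<longrightarrow> (\<exists>k::nat. \<delta> = 1 / 2 ^ k) \<longrightarrow>
        real m = (1 - \<delta>) * real n \<longrightarrow>
        probe_distribution n D \<longrightarrow>
        expected_final_time D m \<ge> ennreal (c * (log 2 (1 / \<delta>))\<^sup>2))"
proof (intro exI[of _ "1 / 4000"] conjI allI impI)
  fix n m :: nat and \<delta> :: real and D :: "probe_seq measure"
  assume n: "n > 0" and \<delta>: "0 < \<delta>" "\<delta> < 1" and ex: "\<exists>k::nat. \<delta> = 1 / 2 ^ k"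
    and m: "real m = (1 - \<delta>) * real n" and D: "probe_distribution n D"
  from ex obtain k :: nat where k: "\<delta> = 1 / 2 ^ k" by blast
  interpret probing D n
    using D by (auto simp: probe_distribution_def probing_def probing_axioms_def)
  have log: "log 2 (1 / \<delta>) = real k"
    by (simp add: k log_nat_power)
  have "0 < real m" using m n \<delta> by simp
  then obtain t where t: "m = Suc t" using gr0_implies_Suc by auto
  show "ennreal (1 / 4000 * (log 2 (1 / \<delta>))\<^sup>2) \<le> expected_final_time D m"
  proof (cases "k < 16")
    case True
    \<comment> \<open>Here \<open>k div 16\<close> would be 0; the trivial bound 1 suffices because
      \<open>225 \<le> 4000\<close>.\<close>
    have "(real k)\<^sup>2 \<le> 15\<^sup>2" using True by (intro power_mono) auto
    then have "ennreal (1 / 4000 * (real k)\<^sup>2) \<le> 1"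
      by (simp add: ennreal_le_1)
    then show ?thesis
      unfolding log t using expected_final_time_ge_1[of t] by (rule order_trans)
  next
    case False
    define N where "N = n - m"
    define q where "q = k div 16"
    have "real m \<le> real n"
      using \<delta> mult_right_mono[of "1 - \<delta>" 1 "real n"] unfolding m by simp
    then have "m \<le> n" by simp
    then have "real N = \<delta> * real n"
      using m by (simp add: N_def algebra_simps)
    then have "real n = real (N * 2 ^ k)" by (simp add: k)
    then have nN: "n = N * 2 ^ k" by linarith
    have "1 \<le> q" "k = q * 16 + k mod 16" "k mod 16 < 16"
      using False by (auto simp: q_def)
    \<comment> \<open>The remainder is at most 15, hence at most \<open>15 * q\<close>, which gives
      \<open>31 * q\<close>.\<close>
    then have q: "1 \<le> q" "16 * q \<le> k" "k \<le> 31 * q"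
      by linarith+
    have "ennreal (3 / 8 * (real q)\<^sup>2) \<le> expected_final_time D (Suc t)"
    proof (rule expected_final_time_ge_square[OF q(1,2) _ nN])
      show "1 \<le> N" using n nN by (cases N) auto
      show "Suc t = n - N" unfolding N_def using \<open>m \<le> n\<close> t by simp
    qed
    moreover have "(real k)\<^sup>2 \<le> (31 * real q)\<^sup>2"
      using q(3) by (intro power_mono) auto
    then have "(real k)\<^sup>2 \<le> 961 * (real q)\<^sup>2"
      by (simp add: power_mult_distrib)
    \<comment> \<open>This holds since \<open>961 / 4000 < 3 / 8\<close>.\<close>
    then have "1 / 4000 * (real k)\<^sup>2 \<le> 3 / 8 * (real q)\<^sup>2"
      using zero_le_power2[of "real q"] by linarith
    ultimately show ?thesis
      unfolding log t by (meson ennreal_leI order_trans)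
  qed
qed simp

end
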